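(* For every positive integer $k$, $$\zeta\left(\bar1,\{1\}_{k-1},3,\{1\}_{k-1}\right)=-\sum_{i=1}^{k-1}\frac{(\ln2)^i}{i!}\,\zeta\left(\bar1,\{1\}_{k-i-1},3,\{1\}_{k-1}\right)-\frac{(\ln2)^k}{k!}\,\zeta\left(\bar3,\{1\}_{k-1}\right)+\frac{(-1)^k}{2}\,\zeta\left(\bar2,\{1\}_{k-1}\right)^2 .$$
   Context: Notation. $\{1\}_r$ denotes the string of $r$ entries equal to $1$ (empty if $r=0$). For positive integers $s_1,\dots,s_r$, $\zeta(s_1,\dots,s_r):=\lim_{n\to\infty}\sum_{n\ge k_1>\cdots>k_r\ge1}\frac{1}{k_1^{s_1}\cdots k_r^{s_r}}$. A bar over an entry $s_j$ means that the factor $(-1)^{k_j}$ is inserted in the summand; e.g. $\zeta(\bar1,\{1\}_{m-1},3,\{1\}_{k-1})=\lim_{n\to\infty}\sum_{n\ge k_1>\cdots>k_{m+k}\ge1}\frac{(-1)^{k_1}}{k_1\cdots k_m\,k_{m+1}^3\,k_{m+2}\cdots k_{m+k}}$. Sums over empty ranges are $0$. *)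

theory Defs
  imports Complex_Main
begin

text \<open>Entries of the argument string of an alternating multiple zeta value; \<open>Bar s\<close> is the
  entry $s$ with a bar over it.\<close>

datatype entry = Plain nat | Bar nat

fun entry_factor :: "entry \<Rightarrow> nat \<Rightarrow> real" where
  "entry_factor (Plain s) k = 1 / real k ^ s"
| "entry_factor (Bar s) k = (-1) ^ k / real k ^ s"

text \<open>The index lists $[k_1,\dots,k_r]$ with $n \ge k_1 > \dots > k_r \ge 1$.\<close>

definition mzv_indices :: "nat \<Rightarrow> nat \<Rightarrow> nat list set" where
  "mzv_indices r n = {ks. length ks = r \<and> sorted_wrt (>) ks \<and> set ks \<subseteq> {1..n}}"

lemma finite_mzv_indices: "finite (mzv_indices r n)"
  by (rule finite_subset [OF _ finite_lists_length_eq [of "{1..n}" r]])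
     (auto simp: mzv_indices_def)

definition mzv_partial :: "entry list \<Rightarrow> nat \<Rightarrow> real" where
  "mzv_partial ss n =
     (\<Sum>ks\<in>mzv_indices (length ss) n. \<Prod>j<length ss. entry_factor (ss ! j) (ks ! j))"

text \<open>The limit is an ordered one, in the outermost index bound; for strings beginning with
  \<open>Bar 1\<close> the convergence is only conditional.\<close>

definition mzv :: "entry list \<Rightarrow> real" where
  "mzv ss = lim (mzv_partial ss)"

abbreviation ones :: "nat \<Rightarrow> entry list" where
  "ones r \<equiv> replicate r (Plain 1)"

end

theory Submission
  imports Defs "HOL-Analysis.Analysis"
begin

text \<open>
  The values with a leading bar are the boundary values at $-1$ of the multiple polylogarithms
  $\mathrm{Li}_{s_1,\dots,s_r}(x)$. Put $F_j = \mathrm{Li}_{\{1\}_j,3,\{1\}_{k-1}}$ and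
  $A = \mathrm{Li}_{2,\{1\}_{k-1}}$. Since $F_{j+1}' = F_j/(1-x)$, the derivative of
  $G = \sum_{i=0}^{k} \frac{(\ln(1-x))^i}{i!} F_{k-i}$ telescopes to
  $\frac{(\ln(1-x))^k}{k!} F_0'$. Here $x F_0' = A$ and
  $x A' = \mathrm{Li}_{\{1\}_k} = \frac{(-\ln(1-x))^k}{k!}$, so $G' = (-1)^k A A'$ and therefore
  $G = \frac{(-1)^k}{2} A^2$. Abel's limit theorem gives the identity at $x = -1$.
\<close>

text \<open>The coefficient at \<open>n\<close> collects the index lists whose largest index is
  \<open>n\<close>; the strict bound \<open>m < n\<close> encodes k_1 > k_2. The empty string has
  its only coefficient at 0, so that the inner sum is the empty product 1 for every
  \<open>n > 0\<close> when the recursion ends.\<close>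

fun polylog_coeff :: "nat list \<Rightarrow> nat \<Rightarrow> real" where
  "polylog_coeff [] n = (if n = 0 then 1 else 0)"
| "polylog_coeff (s # ss) n = (if n = 0 then 0 else (\<Sum>m<n. polylog_coeff ss m) / real n ^ s)"

definition polylog :: "nat list \<Rightarrow> real \<Rightarrow> real" where
  "polylog ss x = (\<Sum>n. polylog_coeff ss n * x ^ n)"

lemma polylog_coeff_nonneg: "0 \<le> polylog_coeff ss n"
  by (induction ss arbitrary: n) (auto intro!: sum_nonneg divide_nonneg_nonneg)

section \<open>Truncated zeta values as sums of power series coefficients\<close>

lemma mzv_partial_Nil [simp]: "mzv_partial [] n = 1"
proof -
  have "mzv_indices 0 n = {[]}"
    by (auto simp: mzv_indices_def)
  then show ?thesis
    by (simp add: mzv_partial_def)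
qed

text \<open>An admissible index list is a head \<open>k\<close> followed by an admissible list
  bounded by \<open>k - 1\<close>. This peeling is what makes induction on the argument string
  possible.\<close>

lemma mzv_partial_Cons:
  "mzv_partial (e # es) n = (\<Sum>k=1..n. entry_factor e k * mzv_partial es (k - 1))"
proof -
  let ?I = "Sigma {1..n} (\<lambda>k. mzv_indices (length es) (k - 1))"
  have "(\<Sum>k=1..n. entry_factor e k * mzv_partial es (k - 1)) =
      (\<Sum>(k, ks)\<in>?I. entry_factor e k * (\<Prod>j<length es. entry_factor (es ! j) (ks ! j)))"
    by (simp add: mzv_partial_def sum_distrib_left sum.Sigma finite_mzv_indices)
  also have "\<dots> = (\<Sum>ks\<in>mzv_indices (Suc (length es)) n.
      \<Prod>j<Suc (length es). entry_factor ((e # es) ! j) (ks ! j))"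
  proof (rule sum.reindex_bij_witness[where i = "\<lambda>ks. (hd ks, tl ks)" and j = "\<lambda>(k, ks). k # ks"])
    fix ks assume ks: "ks \<in> mzv_indices (Suc (length es)) n"
    then obtain k ks' where "ks = k # ks'"
      by (cases ks) (auto simp: mzv_indices_def)
    with ks show "(hd ks, tl ks) \<in> ?I" "(case (hd ks, tl ks) of (k, ks) \<Rightarrow> k # ks) = ks"
      by (force simp: mzv_indices_def)+
  next
    fix p assume p: "p \<in> ?I"
    obtain k ks where pk: "p = (k, ks)" by fastforce
    show "(hd (case p of (k, ks) \<Rightarrow> k # ks), tl (case p of (k, ks) \<Rightarrow> k # ks)) = p"
      by (simp add: pk)
    show "(case p of (k, ks) \<Rightarrow> k # ks) \<in> mzv_indices (Suc (length es)) n"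
      using p by (force simp: mzv_indices_def pk)
    show "(\<Prod>j<Suc (length es). entry_factor ((e # es) ! j) ((case p of (k, ks) \<Rightarrow> k # ks) ! j)) =
        (case p of (k, ks) \<Rightarrow> entry_factor e k * (\<Prod>j<length es. entry_factor (es ! j) (ks ! j)))"
      by (simp only: pk prod.lessThan_Suc_shift) simp
  qed
  finally show ?thesis
    by (simp add: mzv_partial_def)
qed

text \<open>Only the outermost index sees \<open>z\<close>, so one formula serves both cases:
  \<open>z = 1\<close> gives strings without bars, and \<open>z = -1\<close> puts a bar on the
  leading entry.\<close>

lemma sum_atMost_polylog_coeff_Cons:
  "(\<Sum>m\<le>n. polylog_coeff (s # ss) m * z ^ m) =
     (\<Sum>k=1..n. z ^ k / real k ^ s * (\<Sum>m\<le>k - 1. polylog_coeff ss m))"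
proof -
  have "(\<Sum>m\<le>n. polylog_coeff (s # ss) m * z ^ m) = (\<Sum>m=1..n. polylog_coeff (s # ss) m * z ^ m)"
    by (rule sum.mono_neutral_right) auto
  also have "\<dots> = (\<Sum>k=1..n. z ^ k / real k ^ s * (\<Sum>m\<le>k - 1. polylog_coeff ss m))"
  proof (rule sum.cong)
    fix k assume "k \<in> {1..n}"
    then have "{..<k} = {..k - 1}" by auto
    with \<open>k \<in> {1..n}\<close> show "polylog_coeff (s # ss) k * z ^ k =
        z ^ k / real k ^ s * (\<Sum>m\<le>k - 1. polylog_coeff ss m)"
      by simp
  qed simp
  finally show ?thesis .
qed

lemma mzv_partial_Plain: "mzv_partial (map Plain ss) n = (\<Sum>m\<le>n. polylog_coeff ss m)"
proof (induction ss arbitrary: n)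
  case Nil
  then show ?case by (simp add: sum.delta)
next
  case (Cons s ss)
  then show ?case
    using sum_atMost_polylog_coeff_Cons[of s ss 1 n] by (simp add: mzv_partial_Cons)
qed

lemma mzv_partial_Bar:
  "mzv_partial (Bar s # map Plain ss) n = (\<Sum>m\<le>n. polylog_coeff (s # ss) m * (-1) ^ m)"
  by (simp only: sum_atMost_polylog_coeff_Cons mzv_partial_Cons mzv_partial_Plain entry_factor.simps)

section \<open>Growth of the coefficients\<close>

lemma sum_inverse_sqrt_le: "(\<Sum>k=1..n. 1 / sqrt (real k)) \<le> 2 * sqrt (real n)"
proof (induction n)
  case (Suc n)
  let ?a = "sqrt (real n)" and ?b = "sqrt (real (Suc n))"
  \<comment> \<open>Expanding this square with b^2 = a^2 + 1 gives 1 + 2ab <= 2b^2; division by b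
    turns it into the increment bound 1/b <= 2(b - a).\<close>
  have "0 \<le> (?b - ?a)\<^sup>2" by simp
  moreover have "?b\<^sup>2 = ?a\<^sup>2 + 1" by simp
  ultimately have "1 + 2 * ?a * ?b \<le> 2 * ?b * ?b"
    by (simp add: power2_diff power2_eq_square algebra_simps)
  moreover have "?b > 0" by simp
  ultimately have "1 / ?b + 2 * ?a \<le> 2 * ?b"
    by (simp add: field_simps)
  with Suc show ?case by simp
qed simp

text \<open>The true growth is at most a power of the logarithm, but the cruder square root
  reproduces itself under the recursion: dividing by \<open>k\<close> leaves k^(-1/2), which sums to
  at most 2 sqrt n. Each entry thus costs one factor 2.\<close>

lemma sum_lessThan_polylog_coeff_le:
  assumes "0 \<notin> set ss"
  shows "(\<Sum>m<n. polylog_coeff ss m) \<le> 2 ^ length ss * sqrt (real n)"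
  using assms
proof (induction ss arbitrary: n)
  case Nil
  then show ?case by (cases n) (simp_all add: sum.lessThan_Suc_shift)
next
  case (Cons s ss)
  have "(\<Sum>m<n. polylog_coeff (s # ss) m) \<le> (\<Sum>m\<le>n. polylog_coeff (s # ss) m)"
    by (rule sum_mono2) (auto intro!: sum_nonneg polylog_coeff_nonneg divide_nonneg_nonneg)
  also have "\<dots> = (\<Sum>m=1..n. polylog_coeff (s # ss) m)"
    by (rule sum.mono_neutral_right) auto
  also have "\<dots> \<le> (\<Sum>m=1..n. 2 ^ length ss * (1 / sqrt (real m)))"
  proof (rule sum_mono)
    fix k assume k: "k \<in> {1..n}"
    have "real k ^ 1 \<le> real k ^ s"
      using k Cons.prems by (intro power_increasing) auto
    then have "polylog_coeff (s # ss) k \<le> (2 ^ length ss * sqrt (real k)) / real k"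
      using k Cons by (auto intro!: frac_le)
    also have "\<dots> = 2 ^ length ss * (1 / sqrt (real k))"
      using k by (simp add: field_simps)
    finally show "polylog_coeff (s # ss) k \<le> 2 ^ length ss * (1 / sqrt (real k))" .
  qed
  also have "\<dots> = 2 ^ length ss * (\<Sum>m=1..n. 1 / sqrt (real m))"
    by (simp add: sum_distrib_left)
  also have "\<dots> \<le> 2 ^ length ss * (2 * sqrt (real n))"
    by (intro mult_left_mono sum_inverse_sqrt_le) auto
  finally show ?case by (simp add: mult_ac)
qed

lemma polylog_coeff_le:
  assumes "0 \<notin> set ss" "n > 0"
  shows "polylog_coeff (s # ss) n \<le> 2 ^ length ss * real n powr (1 / 2 - real s)"
proof -
  have "polylog_coeff (s # ss) n \<le> (2 ^ length ss * sqrt (real n)) / real n ^ s"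
    using assms sum_lessThan_polylog_coeff_le[OF assms(1), of n] by (auto intro!: divide_right_mono)
  also have "\<dots> = 2 ^ length ss * real n powr (1 / 2 - real s)"
    using assms(2) by (simp add: powr_diff powr_half_sqrt powr_realpow)
  finally show ?thesis .
qed

lemma polylog_coeff_le':
  assumes "0 \<notin> set ss" "n > 0"
  shows "polylog_coeff ss n \<le> 2 ^ length ss * real n powr (- 1 / 2)"
proof (cases ss)
  case (Cons s ts)
  have "polylog_coeff ss n \<le> 2 ^ length ts * real n powr (1 / 2 - real s)"
    using polylog_coeff_le[of ts n s] assms Cons by simp
  also have "\<dots> \<le> 2 ^ length ss * real n powr (- 1 / 2)"
    using assms Cons by (intro mult_mono powr_mono power_increasing) auto
  finally show ?thesis .
qed (use assms in auto)

section \<open>Convergence inside the unit disc and Abel limits at -1\<close>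

lemma polylog_coeff_tendsto_0:
  assumes "0 \<notin> set ss"
  shows "polylog_coeff ss \<longlonglongrightarrow> 0"
proof (rule tendsto_sandwich)
  show "\<forall>\<^sub>F n in sequentially. 0 \<le> polylog_coeff ss n"
    by (simp add: polylog_coeff_nonneg)
  show "\<forall>\<^sub>F n in sequentially. polylog_coeff ss n \<le> 2 ^ length ss * real n powr (- 1 / 2)"
    using polylog_coeff_le'[OF assms] by (intro eventually_mono[OF eventually_gt_at_top[of 0]])
  have "(\<lambda>n. real n powr (- 1 / 2)) \<longlonglongrightarrow> 0"
    by (intro tendsto_neg_powr filterlim_real_sequentially) auto
  then show "(\<lambda>n. 2 ^ length ss * real n powr (- 1 / 2)) \<longlonglongrightarrow> 0"
    by (rule tendsto_mult_right_zero)
qed auto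

lemma summable_polylog:
  assumes "0 \<notin> set ss" "\<bar>x\<bar> < 1"
  shows "summable (\<lambda>n. polylog_coeff ss n * x ^ n)"
proof (rule summable_comparison_test_ev)
  have "\<forall>\<^sub>F n in sequentially. polylog_coeff ss n < 1"
    using polylog_coeff_tendsto_0[OF assms(1)] by (rule order_tendstoD) simp
  then show "\<forall>\<^sub>F n in sequentially. norm (polylog_coeff ss n * x ^ n) \<le> \<bar>x\<bar> ^ n"
    by eventually_elim
      (auto simp: abs_mult power_abs polylog_coeff_nonneg intro!: mult_left_le_one_le)
  show "summable (\<lambda>n. \<bar>x\<bar> ^ n)"
    using assms(2) by (simp add: summable_geometric_iff)
qed

text \<open>For a leading entry at least 2 the coefficients themselves are summable. For leading
  entry 1 they are not in general, but their differences gain a factor of about 1/n and are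
  O(n^(-3/2)).\<close>

lemma summable_abs_diff_polylog_coeff:
  assumes "0 \<notin> set (s # ss)"
  shows "summable (\<lambda>n. \<bar>polylog_coeff (s # ss) (Suc n) - polylog_coeff (s # ss) n\<bar>)"
proof (cases "s = 1")
  case True
  show ?thesis
  proof (rule summable_comparison_test_ev)
    show "summable (\<lambda>n. 2 * 2 ^ length ss * real n powr (- 3 / 2))"
      by (intro summable_mult) (simp add: summable_real_powr_iff)
    show "\<forall>\<^sub>F n in sequentially. norm \<bar>polylog_coeff (s # ss) (Suc n) - polylog_coeff (s # ss) n\<bar>
        \<le> 2 * 2 ^ length ss * real n powr (- 3 / 2)"
      using eventually_gt_at_top[of 0]
    proof eventually_elim
      case (elim n)
      let ?P = "\<Sum>m<n. polylog_coeff ss m" and ?B = "2 ^ length ss * real n powr (- 3 / 2)"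
      have P: "0 \<le> ?P" by (simp add: sum_nonneg polylog_coeff_nonneg)
      \<comment> \<open>The difference splits into the term newly entering the inner sum and the
        effect of the larger denominator. Both are nonnegative, and each is bounded by
        \<open>?B\<close>.\<close>
      have "polylog_coeff (s # ss) (Suc n) - polylog_coeff (s # ss) n =
          polylog_coeff ss n / (n + 1) - ?P / (n * (n + 1))"
      proof -
        have "(P + c) / (y + 1) - P / y = c / (y + 1) - P / (y * (y + 1))" if "y > 0" for P c y :: real
        proof -
          have "P / y = P / (y + 1) + P / (y * (y + 1))"
            using that by (simp add: divide_simps) (simp add: algebra_simps)
          then show ?thesis by (simp add: add_divide_distrib)
        qed
        from this[of n ?P "polylog_coeff ss n"] elim show ?thesis
          by (simp add: True add.commute) (simp add: algebra_simps)
      qed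
      moreover have "polylog_coeff ss n / (n + 1) \<le> ?B"
      proof -
        have "polylog_coeff ss n / (n + 1) \<le> 2 ^ length ss * real n powr (- 1 / 2) / n"
          using elim assms polylog_coeff_le'[of ss n] by (intro frac_le) (auto simp: polylog_coeff_nonneg)
        also have "\<dots> = 2 ^ length ss * (real n powr (- 1 / 2) / real n powr 1)"
          using elim by simp
        also have "\<dots> = ?B"
          unfolding powr_diff[symmetric] by simp
        finally show ?thesis .
      qed
      moreover have "?P / (n * (n + 1)) \<le> ?B"
      proof -
        have "?P / (n * (n + 1)) \<le> ?P / (real n * real n)"
          using elim P by (intro frac_le) auto
        \<comment> \<open>Recognising a coefficient with leading entry 2 lets the general bound
          supply the exponent 1/2 - 2 = -3/2.\<close>
        also have "\<dots> = polylog_coeff (2 # ss) n"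
          using elim by (simp add: power2_eq_square)
        also have "\<dots> \<le> ?B"
          using polylog_coeff_le[of ss n 2] elim assms by simp
        finally show ?thesis .
      qed
      moreover have "0 \<le> polylog_coeff ss n / (n + 1)" "0 \<le> ?P / (n * (n + 1))"
        using P by (auto simp: polylog_coeff_nonneg)
      ultimately show ?case
        unfolding real_norm_def abs_idempotent by linarith
    qed
  qed
next
  case False
  with assms have s: "s \<ge> 2" by (cases s) auto
  have sm: "summable (polylog_coeff (s # ss))"
  proof (rule summable_comparison_test_ev)
    show "summable (\<lambda>n. 2 ^ length ss * real n powr (1 / 2 - real s))"
      using s by (intro summable_mult) (simp add: summable_real_powr_iff)
    show "\<forall>\<^sub>F n in sequentially. norm (polylog_coeff (s # ss) n)
        \<le> 2 ^ length ss * real n powr (1 / 2 - real s)"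
      using eventually_gt_at_top[of 0]
      by eventually_elim
        (use polylog_coeff_le[of ss _ s] assms in
          \<open>simp del: polylog_coeff.simps add: polylog_coeff_nonneg\<close>)
  qed
  show ?thesis
  proof (rule summable_comparison_test_ev)
    show "summable (\<lambda>n. polylog_coeff (s # ss) (Suc n) + polylog_coeff (s # ss) n)"
      using sm by (intro summable_add) (simp_all only: summable_Suc_iff)
    have "norm \<bar>a - b\<bar> \<le> a + b" if "0 \<le> a" "0 \<le> b" for a b :: real
      using that by auto
    then show "\<forall>\<^sub>F n in sequentially. norm \<bar>polylog_coeff (s # ss) (Suc n) - polylog_coeff (s # ss) n\<bar>
        \<le> polylog_coeff (s # ss) (Suc n) + polylog_coeff (s # ss) n"
      by (auto simp del: polylog_coeff.simps simp: polylog_coeff_nonneg)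
  qed
qed

text \<open>Subtracting from the series of partial sums its shift by one power of \<open>x\<close>
  leaves the series of the summands \<open>d\<close>. Besides the Abel limit below, this produces
  the factor 1/(1 - x) in the derivative for leading entry 1.\<close>

lemma powser_partial_sums:
  fixes d :: "nat \<Rightarrow> real"
  assumes "summable (\<lambda>n. (\<Sum>m\<le>n. d m) * x ^ n)"
  shows "(\<lambda>n. d n * x ^ n) sums ((1 - x) * (\<Sum>n. (\<Sum>m\<le>n. d m) * x ^ n))"
proof -
  let ?a = "\<lambda>n. \<Sum>m\<le>n. d m"
  let ?S = "\<Sum>n. ?a n * x ^ n"
  let ?b = "\<lambda>n. case n of 0 \<Rightarrow> 0 | Suc m \<Rightarrow> ?a m * x ^ Suc m"
  have S: "(\<lambda>n. ?a n * x ^ n) sums ?S"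
    using assms by (rule summable_sums)
  then have "(\<lambda>n. ?b (Suc n)) sums (x * ?S)"
    using sums_mult[of _ ?S x] by (simp add: mult_ac)
  then have "?b sums (x * ?S)"
    using sums_Suc[of ?b] by force
  from sums_diff[OF S this] have "(\<lambda>n. ?a n * x ^ n - ?b n) sums (?S - x * ?S)" .
  moreover have "?a n * x ^ n - ?b n = d n * x ^ n" for n
    by (cases n) (simp_all add: algebra_simps)
  ultimately show ?thesis
    by (simp add: algebra_simps)
qed

text \<open>Multiplication by \<open>1 - x\<close> replaces the coefficients by their differences, so that the
  resulting series converges absolutely at \<open>x = -1\<close>.\<close>

lemma abel_limit_alternating:
  fixes a :: "nat \<Rightarrow> real"
  assumes "summable (\<lambda>n. \<bar>a (Suc n) - a n\<bar>)" and lim0: "a \<longlonglongrightarrow> 0"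
    and sm: "\<And>x. \<bar>x\<bar> < 1 \<Longrightarrow> summable (\<lambda>n. a n * x ^ n)"
  obtains l where "(\<lambda>N. \<Sum>n\<le>N. a n * (-1) ^ n) \<longlonglongrightarrow> l"
    and "((\<lambda>x. \<Sum>n. a n * x ^ n) \<longlongrightarrow> l) (at_right (-1))"
proof -
  define d where "d n = (case n of 0 \<Rightarrow> a 0 | Suc m \<Rightarrow> a (Suc m) - a m)" for n
  define g where "g x = (\<Sum>n. d n * x ^ n)" for x
  have ad: "(\<Sum>m\<le>n. d m) = a n" for n
    by (induction n) (simp_all add: d_def)
  have "summable (\<lambda>n. \<bar>d (Suc n)\<bar>)"
    using assms(1) by (simp add: d_def)
  then have sd: "summable (\<lambda>n. \<bar>d n\<bar>)"
    by (subst (asm) summable_Suc_iff)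
  have bound: "norm (d n * x ^ n) \<le> \<bar>d n\<bar>" if "x \<in> {-1..1}" for n x
    using that by (auto simp: abs_mult power_abs intro!: mult_right_le_one_le power_le_one)
  have "uniform_limit {-1..1} (\<lambda>N x. \<Sum>n<N. d n * x ^ n) g sequentially"
    unfolding g_def using bound sd by (intro Weierstrass_m_test) auto
  then have "continuous_on {-1..1} g"
    by (rule uniform_limit_theorem[rotated]) (auto intro!: always_eventually continuous_intros)
  then have gl: "(g \<longlongrightarrow> g (-1)) (at_right (-1))"
    by (rule continuous_on_Icc_at_rightD) simp
  have "\<forall>\<^sub>F x in at_right (-1). x \<in> {-1<..<1::real}"
    by (rule eventually_at_right_real) simp
  then have "\<forall>\<^sub>F x in at_right (-1). g x / (1 - x) = (\<Sum>n. a n * x ^ n)"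
  proof eventually_elim
    case (elim x)
    then have "summable (\<lambda>n. a n * x ^ n)"
      by (intro sm) auto
    from powser_partial_sums[of d x, unfolded ad, OF this] elim show ?case
      by (simp add: g_def sums_iff)
  qed
  moreover have "((\<lambda>x. g x / (1 - x)) \<longlongrightarrow> g (-1) / (1 - (-1))) (at_right (-1))"
    by (intro tendsto_intros gl) auto
  ultimately have f: "((\<lambda>x. \<Sum>n. a n * x ^ n) \<longlongrightarrow> g (-1) / (1 - (-1))) (at_right (-1))"
    by (rule Lim_transform_eventually[rotated])
  have "summable (\<lambda>n. d n * (-1) ^ n)"
    by (rule summable_comparison_test'[OF sd]) (use bound[of "-1"] in auto)
  then have "(\<lambda>N. \<Sum>n\<le>N. d n * (-1) ^ n) \<longlonglongrightarrow> g (-1)"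
    unfolding g_def by (rule summable_LIMSEQ')
  moreover have "(\<lambda>N. a N * (-1) ^ N) \<longlonglongrightarrow> 0"
    by (rule tendsto_rabs_zero_cancel) (use tendsto_rabs_zero[OF lim0] in \<open>simp add: abs_mult\<close>)
  ultimately have "(\<lambda>N. ((\<Sum>n\<le>N. d n * (-1) ^ n) + a N * (-1) ^ N) / (1 - (-1)))
      \<longlonglongrightarrow> (g (-1) + 0) / (1 - (-1))"
    by (intro tendsto_intros) auto
  \<comment> \<open>This is multiplication by 1 - x at x = -1 for truncated sums: the truncation
    leaves the boundary term a_N (-1)^N, which has just been shown to vanish in the limit.\<close>
  moreover have "((\<Sum>n\<le>N. d n * (-1) ^ n) + a N * (-1) ^ N) / (1 - (-1)) =
      (\<Sum>n\<le>N. a n * (-1) ^ n)" for N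
    by (induction N) (simp_all add: d_def field_simps)
  ultimately have "(\<lambda>N. \<Sum>n\<le>N. a n * (-1) ^ n) \<longlonglongrightarrow> g (-1) / (1 - (-1))"
    by simp
  with f show ?thesis
    using that by blast
qed

text \<open>One number is the limit both of the truncated sums and of the function. Hence
  \<open>lim\<close> in the definition of \<open>mzv\<close> is a genuine limit here, also for the
  leading entry \<open>Bar 1\<close>.\<close>

lemma polylog_tendsto_mzv:
  assumes "0 \<notin> set (s # ss)"
  shows "(polylog (s # ss) \<longlongrightarrow> mzv (Bar s # map Plain ss)) (at_right (-1))"
proof -
  obtain l where l: "(\<lambda>N. \<Sum>n\<le>N. polylog_coeff (s # ss) n * (-1) ^ n) \<longlonglongrightarrow> l"
    "((\<lambda>x. \<Sum>n. polylog_coeff (s # ss) n * x ^ n) \<longlongrightarrow> l) (at_right (-1))"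
    using abel_limit_alternating[OF summable_abs_diff_polylog_coeff[OF assms]
        polylog_coeff_tendsto_0[OF assms] summable_polylog[OF assms]] by blast
  have "mzv_partial (Bar s # map Plain ss) = (\<lambda>N. \<Sum>n\<le>N. polylog_coeff (s # ss) n * (-1) ^ n)"
    by (intro ext mzv_partial_Bar)
  with l(1) have "mzv (Bar s # map Plain ss) = l"
    unfolding mzv_def by (simp add: limI)
  with l(2) show ?thesis
    unfolding polylog_def[abs_def] by simp
qed

section \<open>Differential equations of the multiple polylogarithms\<close>

lemma polylog_Cons_0 [simp]: "polylog (s # ss) 0 = 0"
  using powser_zero[of "polylog_coeff (s # ss)"] by (simp add: polylog_def)

lemma polylog_Nil [simp]: "polylog [] x = 1"
proof -
  have "(\<lambda>n. polylog_coeff [] n * x ^ n) sums (\<Sum>n\<in>{0}. polylog_coeff [] n * x ^ n)"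
    by (rule sums_finite) auto
  then show ?thesis
    by (simp add: polylog_def sums_iff)
qed

lemma has_real_derivative_polylog:
  assumes "0 \<notin> set ss" "\<bar>x\<bar> < 1"
  shows "(polylog ss has_real_derivative (\<Sum>n. diffs (polylog_coeff ss) n * x ^ n)) (at x)"
  unfolding polylog_def[abs_def]
  by (rule termdiffs_strong'[where K = 1]) (use assms summable_polylog in auto)

text \<open>Termwise differentiation cancels the denominator n and leaves the partial sums of the
  inner coefficients, whose generating function is that of \<open>ss\<close> divided by 1 -
  x.\<close>

lemma has_real_derivative_polylog_1:
  assumes "0 \<notin> set ss" "\<bar>x\<bar> < 1"
  shows "(polylog (1 # ss) has_real_derivative polylog ss x / (1 - x)) (at x)"
proof -
  have eq: "diffs (polylog_coeff (1 # ss)) n = (\<Sum>m\<le>n. polylog_coeff ss m)" for n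
    by (simp add: diffs_def lessThan_Suc_atMost add_nonneg_eq_0_iff)
  have "summable (\<lambda>n. (\<Sum>m\<le>n. polylog_coeff ss m) * x ^ n)"
  proof (rule termdiff_converges[of x 1 "polylog_coeff (1 # ss)", unfolded eq])
    show "summable (\<lambda>n. polylog_coeff (1 # ss) n * y ^ n)" if "norm y < 1" for y
      using that assms by (intro summable_polylog) auto
  qed (use assms in auto)
  from powser_partial_sums[OF this]
  have "(\<Sum>n. (\<Sum>m\<le>n. polylog_coeff ss m) * x ^ n) = polylog ss x / (1 - x)"
    using assms by (simp add: polylog_def sums_iff)
  with has_real_derivative_polylog[of "1 # ss" x] assms show ?thesis
    by (simp only: eq) simp
qed

text \<open>Differentiation followed by multiplication by \<open>x\<close> multiplies the nth
  coefficient by n, lowering the leading exponent by one. The product form \<open>x * D\<close>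
  avoids dividing by \<open>x\<close> and so covers \<open>x = 0\<close>.\<close>

lemma has_real_derivative_polylog_Suc:
  assumes "0 \<notin> set (s # ss)" "\<bar>x\<bar> < 1"
  obtains D where "(polylog (Suc s # ss) has_real_derivative D) (at x)"
    and "x * D = polylog (s # ss) x"
proof (rule that[OF has_real_derivative_polylog])
  let ?c = "polylog_coeff (Suc s # ss)"
  have "summable (\<lambda>n. diffs ?c n * x ^ n)"
  proof (rule termdiff_converges[of x 1])
    show "summable (\<lambda>n. ?c n * y ^ n)" if "norm y < 1" for y
      using that assms by (intro summable_polylog) auto
  qed (use assms in auto)
  then have "(\<lambda>n. x * (diffs ?c n * x ^ n)) sums (x * (\<Sum>n. diffs ?c n * x ^ n))"
    by (intro sums_mult summable_sums)
  moreover have "x * (diffs ?c n * x ^ n) = polylog_coeff (s # ss) (Suc n) * x ^ Suc n" for n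
    by (simp add: diffs_def add_nonneg_eq_0_iff)
  ultimately have "(\<lambda>n. polylog_coeff (s # ss) (Suc n) * x ^ Suc n) sums
      (x * (\<Sum>n. diffs ?c n * x ^ n))"
    by (simp only:)
  then have "(\<lambda>n. polylog_coeff (s # ss) n * x ^ n) sums (x * (\<Sum>n. diffs ?c n * x ^ n))"
    by (subst (asm) sums_Suc_iff) simp
  then show "x * (\<Sum>n. diffs ?c n * x ^ n) = polylog (s # ss) x"
    by (simp only: polylog_def sums_iff)
qed (use assms in auto)

section \<open>Powers of the logarithm and the closed form of G\<close>

lemma has_real_derivative_power_fact:
  fixes f :: "real \<Rightarrow> real"
  assumes "(f has_real_derivative D) (at x)"
  shows "((\<lambda>x. f x ^ Suc j / fact (Suc j)) has_real_derivative f x ^ j / fact j * D) (at x)"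
proof (rule DERIV_cong[OF DERIV_cdivide[OF DERIV_power_Suc[OF assms]]])
  show "(1 + real j) * (D * f x ^ j) / fact (Suc j) = f x ^ j / fact j * D"
    by (simp add: fact_Suc add_nonneg_eq_0_iff)
qed

text \<open>By induction on \<open>k\<close>, both sides have the same derivative on (-1, 1), and
  for positive length both vanish at 0.\<close>

lemma polylog_ones:
  assumes "\<bar>x\<bar> < 1"
  shows "polylog (replicate k 1) x = (- ln (1 - x)) ^ k / fact k"
  using assms
proof (induction k arbitrary: x)
  case (Suc k)
  let ?h = "\<lambda>x. polylog (replicate (Suc k) 1) x - (- ln (1 - x)) ^ Suc k / fact (Suc k)"
  have "(?h has_real_derivative 0) (at x)" if "x \<in> {-1<..<1}" for x
  proof -
    from that have x: "\<bar>x\<bar> < 1" "1 - x > 0" by auto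
    have "((\<lambda>x. polylog (replicate (Suc k) 1) x) has_real_derivative
        (- ln (1 - x)) ^ k / fact k / (1 - x)) (at x)"
      using has_real_derivative_polylog_1[of "replicate k 1" x] Suc.IH[OF x(1)] x(1) by simp
    moreover have "((\<lambda>x. (- ln (1 - x)) ^ Suc k / fact (Suc k)) has_real_derivative
        (- ln (1 - x)) ^ k / fact k / (1 - x)) (at x)"
    proof (rule DERIV_cong[OF has_real_derivative_power_fact])
      show "((\<lambda>x. - ln (1 - x)) has_real_derivative 1 / (1 - x)) (at x)"
        using x by (auto intro!: derivative_eq_intros)
    qed simp
    ultimately show ?thesis
      using DERIV_diff by fastforce
  qed
  then have "?h x = ?h 0"
    using Suc.prems by (intro DERIV_isconst3[of "-1" 1]) auto
  then show ?case by simp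
qed simp

lemma has_real_derivative_ln_telescope:
  fixes F :: "nat \<Rightarrow> real \<Rightarrow> real"
  assumes "x < 1" "(F 0 has_real_derivative D) (at x)"
    and "\<And>j. (F (Suc j) has_real_derivative F j x / (1 - x)) (at x)"
  shows "((\<lambda>x. \<Sum>i\<le>k. ln (1 - x) ^ i / fact i * F (k - i) x) has_real_derivative
    ln (1 - x) ^ k / fact k * D) (at x)"
proof -
  \<comment> \<open>In the ith summand, differentiating the logarithm power contributes
    \<open>- w i\<close>, and for \<open>i < k\<close> differentiating \<open>F (k - i)\<close>
    contributes \<open>w (Suc i)\<close>. The sum over \<open>i < k\<close> is therefore
    \<open>w k\<close>, which cancels against the last summand.\<close>
  define w where "w i = (case i of 0 \<Rightarrow> 0
      | Suc j \<Rightarrow> ln (1 - x) ^ j / fact j * F (k - i) x / (1 - x))" for i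
  have pow: "((\<lambda>x. ln (1 - x) ^ i / fact i) has_real_derivative
      - (case i of 0 \<Rightarrow> 0 | Suc j \<Rightarrow> ln (1 - x) ^ j / fact j / (1 - x))) (at x)" for i
  proof (cases i)
    case (Suc j)
    show ?thesis
      unfolding Suc
    proof (rule DERIV_cong[OF has_real_derivative_power_fact])
      show "((\<lambda>x. ln (1 - x)) has_real_derivative - 1 / (1 - x)) (at x)"
        using assms(1) by (auto intro!: derivative_eq_intros)
    qed simp
  qed simp
  have "((\<lambda>x. ln (1 - x) ^ i / fact i * F (k - i) x) has_real_derivative w (Suc i) - w i) (at x)"
    if "i < k" for i
  proof -
    from that have "k - i = Suc (k - Suc i)" by simp
    then have "(F (k - i) has_real_derivative F (k - Suc i) x / (1 - x)) (at x)"
      using assms(3) by simp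
    from DERIV_mult[OF pow[of i] this] show ?thesis
      by (rule DERIV_cong) (simp add: w_def mult_ac split: nat.split)
  qed
  then have "((\<lambda>x. \<Sum>i<k. ln (1 - x) ^ i / fact i * F (k - i) x) has_real_derivative
      (\<Sum>i<k. w (Suc i) - w i)) (at x)"
    by (intro DERIV_sum) auto
  from DERIV_add[OF this DERIV_mult[OF pow[of k] assms(2)]]
  show ?thesis
    unfolding lessThan_Suc_atMost[symmetric] sum.lessThan_Suc sum_lessThan_telescope
    by (simp add: w_def mult_ac split: nat.splits)
qed

lemma polylog_ln_sum:
  assumes "k \<ge> 1" "\<bar>x\<bar> < 1"
  shows "(\<Sum>i\<le>k. ln (1 - x) ^ i / fact i * polylog (replicate (k - i) 1 @ 3 # replicate (k - 1) 1) x)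
    = (-1) ^ k / 2 * (polylog (2 # replicate (k - 1) 1) x)\<^sup>2"
proof -
  define F where "F j = polylog (replicate j 1 @ 3 # replicate (k - 1) 1)" for j
  define A where "A = polylog (2 # replicate (k - 1) 1)"
  define h where "h x = (\<Sum>i\<le>k. ln (1 - x) ^ i / fact i * F (k - i) x) - (-1) ^ k / 2 * (A x)\<^sup>2" for x
  have "(h has_real_derivative 0) (at x)" if "x \<in> {-1<..<1}" for x
  proof -
    from that have x: "\<bar>x\<bar> < 1" "x < 1" by auto
    obtain D where D: "(F 0 has_real_derivative D) (at x)" "x * D = A x"
      using has_real_derivative_polylog_Suc[of 2 "replicate (k - 1) 1" x] x
      by (auto simp: F_def A_def numeral_3_eq_3 numeral_2_eq_2)
    have ones: "1 # replicate (k - 1) 1 = replicate k (1::nat)"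
      using assms(1) by (cases k) auto
    obtain E where E: "(A has_real_derivative E) (at x)" "x * E = (- ln (1 - x)) ^ k / fact k"
      using has_real_derivative_polylog_Suc[of 1 "replicate (k - 1) 1" x] x polylog_ones[of x k]
      unfolding ones by (auto simp: A_def numeral_2_eq_2)
    have "(F (Suc j) has_real_derivative F j x / (1 - x)) (at x)" for j
      unfolding F_def using has_real_derivative_polylog_1[of "replicate j 1 @ 3 # replicate (k - 1) 1" x] x
      by simp
    from has_real_derivative_ln_telescope[OF x(2) D(1) this]
    have "((\<lambda>x. \<Sum>i\<le>k. ln (1 - x) ^ i / fact i * F (k - i) x) has_real_derivative
        ln (1 - x) ^ k / fact k * D) (at x)" .
    moreover have "((\<lambda>x. (-1) ^ k / 2 * (A x)\<^sup>2) has_real_derivative (-1) ^ k * A x * E) (at x)"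
      by (rule derivative_eq_intros E(1) refl | simp)+
    moreover have "ln (1 - x) ^ k / fact k * D = (-1) ^ k * A x * E"
    \<comment> \<open>The relations for \<open>x * D\<close> and \<open>x * E\<close> say nothing
      about \<open>D\<close> and \<open>E\<close> at 0. There the left side vanishes because ln 1 =
      0 and \<open>k\<close> is positive, the right side because A(0) = 0. Elsewhere the factor
      \<open>x\<close> can be cancelled.\<close>
    proof (cases "x = 0")
      case True
      then show ?thesis using assms(1) by (simp add: A_def)
    next
      case False
      have "x * ((-1) ^ k * A x * E) = (-1) ^ k * A x * (x * E)"
        by simp
      also have "\<dots> = ((-1) * (- ln (1 - x))) ^ k / fact k * A x"
        unfolding E(2) power_mult_distrib by simp
      also have "\<dots> = x * (ln (1 - x) ^ k / fact k * D)"
        by (simp add: D(2)[symmetric])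
      finally show ?thesis
        using False by (simp only: mult_cancel_left) auto
    qed
    ultimately show ?thesis
      unfolding h_def by (auto intro: derivative_eq_intros)
  qed
  then have "h x = h 0"
    using assms by (intro DERIV_isconst3[of "-1" 1]) auto
  also have "F j 0 = 0" for j
    by (cases j) (simp_all add: F_def)
  then have "h 0 = 0"
    by (simp add: h_def A_def)
  finally show ?thesis
    by (simp add: h_def F_def A_def)
qed

section \<open>Passage to the limit at -1\<close>

theorem corollary5p1:
  fixes k :: nat
  assumes "k \<ge> 1"
  shows "mzv ([Bar 1] @ ones (k - 1) @ [Plain 3] @ ones (k - 1)) =
      - (\<Sum>i = 1..k - 1. (ln 2) ^ i / fact i *
            mzv ([Bar 1] @ ones (k - i - 1) @ [Plain 3] @ ones (k - 1)))
      - (ln 2) ^ k / fact k * mzv ([Bar 3] @ ones (k - 1))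
      + (-1) ^ k / 2 * (mzv ([Bar 2] @ ones (k - 1)))\<^sup>2"
proof -
  \<comment> \<open>At \<open>i = k\<close> no entry 1 is left in front and the bar falls on the 3.
    Truncated subtraction would make the general formula still start with \<open>Bar 1\<close>,
    hence the case distinction.\<close>
  define m where "m i = (if i = k then mzv ([Bar 3] @ ones (k - 1))
      else mzv ([Bar 1] @ ones (k - i - 1) @ [Plain 3] @ ones (k - 1)))" for i
  let ?G = "\<lambda>x. \<Sum>i\<le>k. ln (1 - x) ^ i / fact i *
      polylog (replicate (k - i) 1 @ 3 # replicate (k - 1) 1) x"
  have lim_m: "(polylog (replicate (k - i) 1 @ 3 # replicate (k - 1) 1) \<longlongrightarrow> m i) (at_right (-1))"
    if "i \<le> k" for i
  proof (cases "i = k")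
    case True
    then show ?thesis
      using polylog_tendsto_mzv[of 3 "replicate (k - 1) 1"] by (simp add: m_def)
  next
    case False
    with that have "k - i = Suc (k - i - 1)" by simp
    then have "replicate (k - i) (1::nat) = 1 # replicate (k - i - 1) 1"
      by (metis replicate_Suc)
    then have "replicate (k - i) 1 @ 3 # replicate (k - 1) 1 =
        1 # (replicate (k - i - 1) 1 @ 3 # replicate (k - 1) (1::nat))"
      by simp
    then show ?thesis
      using polylog_tendsto_mzv[of 1 "replicate (k - i - 1) 1 @ 3 # replicate (k - 1) 1"] False
      by (simp add: m_def)
  qed
  have "(?G \<longlongrightarrow> (\<Sum>i\<le>k. ln (1 - (-1)) ^ i / fact i * m i)) (at_right (-1))"
    by (intro tendsto_intros lim_m) auto
  moreover have "\<forall>\<^sub>F x in at_right (-1). x \<in> {-1<..<1::real}"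
    by (rule eventually_at_right_real) simp
  then have "\<forall>\<^sub>F x in at_right (-1).
      ?G x = (-1) ^ k / 2 * (polylog (2 # replicate (k - 1) 1) x)\<^sup>2"
    by eventually_elim (rule polylog_ln_sum[OF assms], auto)
  ultimately have "((\<lambda>x. (-1) ^ k / 2 * (polylog (2 # replicate (k - 1) 1) x)\<^sup>2) \<longlongrightarrow>
      (\<Sum>i\<le>k. ln (1 - (-1)) ^ i / fact i * m i)) (at_right (-1))"
    by (rule Lim_transform_eventually)
  moreover have "((\<lambda>x. (-1) ^ k / 2 * (polylog (2 # replicate (k - 1) 1) x)\<^sup>2) \<longlongrightarrow>
      (-1) ^ k / 2 * (mzv ([Bar 2] @ ones (k - 1)))\<^sup>2) (at_right (-1))"
    using polylog_tendsto_mzv[of 2 "replicate (k - 1) 1"] by (intro tendsto_intros) simp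
  ultimately have sum_eq: "(\<Sum>i\<le>k. ln (1 - (-1)) ^ i / fact i * m i) =
      (-1) ^ k / 2 * (mzv ([Bar 2] @ ones (k - 1)))\<^sup>2"
    by (rule tendsto_unique[OF trivial_limit_at_right_real])
  \<comment> \<open>The summand at 0 is the left side of the claim and the one at \<open>k\<close>
    carries the value with leading \<open>Bar 3\<close>; they are distinct because \<open>k\<close>
    is positive.\<close>
  have "{..k} = insert 0 (insert k {1..k - 1})"
    using assms by auto
  then have split: "(\<Sum>i\<le>k. ln (1 - (-1)) ^ i / fact i * m i) =
      m 0 + (ln 2 ^ k / fact k * m k + (\<Sum>i = 1..k - 1. ln 2 ^ i / fact i * m i))"
    using assms by simp
  have inner: "(\<Sum>i = 1..k - 1. (ln 2) ^ i / fact i *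
      mzv ([Bar 1] @ ones (k - i - 1) @ [Plain 3] @ ones (k - 1))) =
      (\<Sum>i = 1..k - 1. ln 2 ^ i / fact i * m i)"
    by (intro sum.cong) (auto simp: m_def)
  have ends: "mzv ([Bar 1] @ ones (k - 1) @ [Plain 3] @ ones (k - 1)) = m 0"
    "mzv ([Bar 3] @ ones (k - 1)) = m k"
    using assms by (auto simp: m_def)
  show ?thesis
    unfolding ends inner using sum_eq unfolding split by linarith
qed

end
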